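(* Let $X_a,X_b\subset\mathbb{R}^2$ be curves and let $ab$ be a double normal with end points $a\in X_a$, $b\in X_b$, $a\ne b$, at both of which the curves are smooth of class $C^2$. Suppose that $(a,b)$ is a Morse critical point of $\mathbb{B}(a,b)=|a-b|^2$ on $X_a\times X_b$, with Hessian $$H(a,b)=I(a)\,I(b)-1 .$$ Then the double normal has the following type: 1. saddle type if $H(a,b)<0$; 2. maximum type if $H(a,b)>0$, $I(a)<0$ and $I(b)<0$; 3. minimum type if $H(a,b)>0$, $I(a)>0$ and $I(b)>0$.
   Context: A double normal $ab$ is an interval orthogonal to $X_a$ at $a$ and orthogonal to $X_b$ at $b$; it is a critical point of $\mathbb{B}$, and its type is the type (minimum, saddle, maximum) of this critical point. The curves are parametrized by arc length near $a$ and $b$, with Frenet frame $(\mathbf{t},\mathbf{n})$ (unit tangent, unit normal) and curvature $\kappa$: $\mathbf{t}'=\kappa\mathbf{n}$, $\mathbf{n}'=-\kappa\mathbf{t}$; lower indices $a$, $b$ refer to the frames and curvatures at $a$ and $b$. For a critical point $x$ on a curve of the squared distance function $y\mapsto$ $\mathbb{D}_y(x)=|x-y|^2$ (as a function of $x$, with $y$ fixed) the index indicator is $I(x)=\kappa\,(x-y)\cdot\mathbf{n}+1$. Thus here $I(a)=\kappa_a\,(a-b)\cdot\mathbf{n}_a+1$ and $I(b)=\kappa_b\,(b-a)\cdot\mathbf{n}_b+1$. The Hessian $H(a,b)$ denotes the determinant of the matrix of second order partial derivatives with respect to the arc length parameters, up to the positive constant factor coming from replacing $\mathbb{B}$ by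 $\frac12\mathbb{B}$. *)

theory Defs
  imports "HOL-Analysis.Analysis"
begin

section \<open>Plane curves near a smooth point\<close>

definition C2_on :: "(real \<Rightarrow> real^2) \<Rightarrow> real set \<Rightarrow> bool" where
  "C2_on \<gamma> S \<longleftrightarrow>
     \<gamma> C1_differentiable_on S \<and> (\<lambda>s. vector_derivative \<gamma> (at s)) C1_differentiable_on S"

text \<open>
  The set \<open>X\<close> is, near its point \<open>p\<close>, an embedded curve of class \<open>C\<^sup>2\<close>, and \<open>\<gamma>\<close> is an arc length
  parametrization of that part of it, with \<open>p\<close> at parameter \<open>0\<close>. No condition is put on \<open>X\<close> away
  from \<open>p\<close>. Since \<open>0\<close> is interior to the parameter interval, \<open>p\<close> is not an end point or a corner
  of \<open>X\<close>; since \<open>X \<inter> U\<close> is all of \<open>X\<close> near \<open>p\<close>, no other branch of \<open>X\<close> passes through \<open>p\<close>.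
\<close>
definition arclength_param_at :: "(real^2) set \<Rightarrow> real^2 \<Rightarrow> (real \<Rightarrow> real^2) \<Rightarrow> bool" where
  "arclength_param_at X p \<gamma> \<longleftrightarrow> \<gamma> 0 = p \<and>
     (\<exists>\<epsilon>>0. \<exists>U g. open U \<and> p \<in> U \<and>
        homeomorphism {-\<epsilon><..<\<epsilon>} (X \<inter> U) \<gamma> g \<and>
        C2_on \<gamma> {-\<epsilon><..<\<epsilon>} \<and>
        (\<forall>s\<in>{-\<epsilon><..<\<epsilon>}. norm (vector_derivative \<gamma> (at s)) = 1))"

definition tangent :: "(real \<Rightarrow> real^2) \<Rightarrow> real \<Rightarrow> real^2" where
  "tangent \<gamma> s = vector_derivative \<gamma> (at s)"

text \<open>
  The normal is the tangent turned by \<open>+90\<close> degrees. The opposite choice of the normal changes the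
  sign of the curvature as well, so the vector \<open>curvature \<gamma> s *\<^sub>R normal \<gamma> s\<close> does not depend on it.
\<close>
definition normal :: "(real \<Rightarrow> real^2) \<Rightarrow> real \<Rightarrow> real^2" where
  "normal \<gamma> s = vector [- (tangent \<gamma> s $ 2), tangent \<gamma> s $ 1]"

definition curvature :: "(real \<Rightarrow> real^2) \<Rightarrow> real \<Rightarrow> real" where
  "curvature \<gamma> s = vector_derivative (tangent \<gamma>) (at s) \<bullet> normal \<gamma> s"

lemma normal_orthonormal:
  assumes "norm (tangent \<gamma> s) = 1"
  shows "tangent \<gamma> s \<bullet> normal \<gamma> s = 0" "norm (normal \<gamma> s) = 1"
  using assms by (auto simp: normal_def norm_eq_sqrt_inner inner_vec_def sum_2 algebra_simps)

text \<open>The curvature just defined is the one of the Frenet equations.\<close>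

lemma Frenet_equations:
  assumes "C2_on \<gamma> S" "open S" "s \<in> S"
    and unit: "\<And>u. u \<in> S \<Longrightarrow> norm (tangent \<gamma> u) = 1"
  shows "(tangent \<gamma> has_vector_derivative curvature \<gamma> s *\<^sub>R normal \<gamma> s) (at s)"
    and "(normal \<gamma> has_vector_derivative - curvature \<gamma> s *\<^sub>R tangent \<gamma> s) (at s)"
proof -
  define t' where "t' = vector_derivative (tangent \<gamma>) (at s)"
  have "tangent \<gamma> C1_differentiable_on S"
    using assms(1) unfolding C2_on_def tangent_def by simp
  then have "tangent \<gamma> differentiable at s"
    using \<open>s \<in> S\<close> by (meson C1_differentiable_on_eq)
  then have D: "(tangent \<gamma> has_vector_derivative t') (at s)"
    unfolding t'_def by (simp add: vector_derivative_works)
  have D_inner: "((\<lambda>u. tangent \<gamma> u \<bullet> tangent \<gamma> u) has_vector_derivative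
      tangent \<gamma> s \<bullet> t' + t' \<bullet> tangent \<gamma> s) (at s)"
    by (rule bounded_bilinear.has_vector_derivative[OF bounded_bilinear_inner D D])
  have "((\<lambda>u. tangent \<gamma> u \<bullet> tangent \<gamma> u) has_vector_derivative 0) (at s)"
    using has_vector_derivative_transform_within_open[of "\<lambda>_. 1" 0 s S
        "\<lambda>u. tangent \<gamma> u \<bullet> tangent \<gamma> u"]
      \<open>open S\<close> \<open>s \<in> S\<close> unit by (simp add: norm_eq_1)
  with D_inner have orth: "tangent \<gamma> s \<bullet> t' = 0"
    by (metis (no_types, lifting) inner_commute mult_2 mult_eq_0_iff vector_derivative_unique_at
        zero_neq_numeral)
  have one: "(tangent \<gamma> s $ 1)\<^sup>2 + (tangent \<gamma> s $ 2)\<^sup>2 = 1"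
    using unit[OF \<open>s \<in> S\<close>] by (simp add: norm_eq_1 inner_vec_def sum_2 power2_eq_square)
  have orth': "tangent \<gamma> s $ 1 * t' $ 1 + tangent \<gamma> s $ 2 * t' $ 2 = 0"
    using orth by (simp add: inner_vec_def sum_2)
  have kappa: "curvature \<gamma> s = t' $ 2 * tangent \<gamma> s $ 1 - t' $ 1 * tangent \<gamma> s $ 2"
    by (simp add: curvature_def normal_def t'_def inner_vec_def sum_2)
  have "t' $ 1 = - curvature \<gamma> s * tangent \<gamma> s $ 2" "t' $ 2 = curvature \<gamma> s * tangent \<gamma> s $ 1"
    unfolding kappa using one orth' by algebra+
  then have t': "t' = curvature \<gamma> s *\<^sub>R normal \<gamma> s"
    and n': "vector [- (t' $ 2), t' $ 1] = - curvature \<gamma> s *\<^sub>R tangent \<gamma> s"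
    by (simp_all add: vec_eq_iff forall_2 normal_def)
  show "(tangent \<gamma> has_vector_derivative curvature \<gamma> s *\<^sub>R normal \<gamma> s) (at s)"
    using D t' by simp
  have "linear (\<lambda>v :: real^2. vector [- (v $ 2), v $ 1] :: real^2)"
    by (rule linearI) (simp_all add: vec_eq_iff forall_2)
  then have "bounded_linear (\<lambda>v :: real^2. vector [- (v $ 2), v $ 1] :: real^2)"
    by (simp add: linear_conv_bounded_linear)
  from bounded_linear.has_vector_derivative[OF this D]
  have "((\<lambda>u. vector [- (tangent \<gamma> u $ 2), tangent \<gamma> u $ 1] :: real^2)
      has_vector_derivative - curvature \<gamma> s *\<^sub>R tangent \<gamma> s) (at s)"
    by (simp only: n')
  then show "(normal \<gamma> has_vector_derivative - curvature \<gamma> s *\<^sub>R tangent \<gamma> s) (at s)"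
    by (simp add: normal_def[abs_def])
qed

text \<open>
  Index indicator, at the point \<open>\<gamma> s\<close>, of the squared distance from \<open>y\<close> restricted to the curve.
\<close>
definition index_indicator :: "(real \<Rightarrow> real^2) \<Rightarrow> real \<Rightarrow> real^2 \<Rightarrow> real" where
  "index_indicator \<gamma> s y = curvature \<gamma> s * ((\<gamma> s - y) \<bullet> normal \<gamma> s) + 1"


section \<open>Critical points\<close>

text \<open>
  The next three definitions are about a function \<open>F\<close> of two real variables that is twice
  continuously differentiable near \<open>(u, v)\<close>; elsewhere \<^const>\<open>deriv\<close> is an unspecified value.
\<close>

definition critical_point :: "(real \<Rightarrow> real \<Rightarrow> real) \<Rightarrow> real \<Rightarrow> real \<Rightarrow> bool" where
  "critical_point F u v \<longleftrightarrow> deriv (\<lambda>s. F s v) u = 0 \<and> deriv (\<lambda>t. F u t) v = 0"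

definition hessian_matrix :: "(real \<Rightarrow> real \<Rightarrow> real) \<Rightarrow> real \<Rightarrow> real \<Rightarrow> real^2^2" where
  "hessian_matrix F u v = vector
     [vector [deriv (\<lambda>s. deriv (\<lambda>s'. F s' v) s) u, deriv (\<lambda>s. deriv (\<lambda>t. F s t) v) u],
      vector [deriv (\<lambda>t. deriv (\<lambda>s. F s t) u) v, deriv (\<lambda>t. deriv (\<lambda>t'. F u t') t) v]]"

definition Morse_critical_point :: "(real \<Rightarrow> real \<Rightarrow> real) \<Rightarrow> real \<Rightarrow> real \<Rightarrow> bool" where
  "Morse_critical_point F u v \<longleftrightarrow> critical_point F u v \<and> det (hessian_matrix F u v) \<noteq> 0"

text \<open>
  The three types of a critical point \<open>p\<close> of \<open>f\<close> on the space \<open>M\<close>; neighbourhoods of \<open>p\<close> are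
  those in the subspace topology of \<open>M\<close>.
\<close>

definition minimum_type :: "('a::topological_space \<Rightarrow> real) \<Rightarrow> 'a set \<Rightarrow> 'a \<Rightarrow> bool" where
  "minimum_type f M p \<longleftrightarrow> (\<forall>\<^sub>F x in at p within M. f p \<le> f x)"

definition maximum_type :: "('a::topological_space \<Rightarrow> real) \<Rightarrow> 'a set \<Rightarrow> 'a \<Rightarrow> bool" where
  "maximum_type f M p \<longleftrightarrow> (\<forall>\<^sub>F x in at p within M. f x \<le> f p)"

definition saddle_type :: "('a::topological_space \<Rightarrow> real) \<Rightarrow> 'a set \<Rightarrow> 'a \<Rightarrow> bool" where
  "saddle_type f M p \<longleftrightarrow> \<not> minimum_type f M p \<and> \<not> maximum_type f M p"


section \<open>Double normals\<close>

definition sqdist :: "(real^2) \<times> (real^2) \<Rightarrow> real" where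
  "sqdist = (\<lambda>(x, y). (norm (x - y))\<^sup>2)"

text \<open>The segment joining \<open>\<alpha> 0\<close> and \<open>\<beta> 0\<close> is orthogonal to both curves at its end points.\<close>
definition double_normal :: "(real \<Rightarrow> real^2) \<Rightarrow> (real \<Rightarrow> real^2) \<Rightarrow> bool" where
  "double_normal \<alpha> \<beta> \<longleftrightarrow>
     orthogonal (\<alpha> 0 - \<beta> 0) (tangent \<alpha> 0) \<and> orthogonal (\<alpha> 0 - \<beta> 0) (tangent \<beta> 0)"

text \<open>The factor \<open>1/2\<close> is the normalization for which the index indicators are the diagonal entries.\<close>
definition H_det :: "(real \<Rightarrow> real^2) \<Rightarrow> (real \<Rightarrow> real^2) \<Rightarrow> real" where
  "H_det \<alpha> \<beta> = det (hessian_matrix (\<lambda>s t. 1/2 * sqdist (\<alpha> s, \<beta> t)) 0 0)"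

end

(* The two parametrizations identify the filter of neighbourhoods of (a, b) in Xa x Xb with that of
   (0, 0) in the plane, so it suffices to study G(s, t) = |alpha s - beta t|^2. Both unit tangents
   are orthogonal to a - b in the plane, hence parallel, so their inner product sigma satisfies
   sigma^2 = 1, and up to o(s^2 + t^2)
     G(s, t) - G(0, 0) = I(a) s^2 - 2 sigma s t + I(b) t^2.
   This quadratic form has determinant I(a) I(b) - 1, which decides its definiteness. *)

theory Submission
  imports Defs
begin

section \<open>Passage from neighbourhoods on the curves to neighbourhoods in the parameter
  plane\<close>

text \<open>The types refer to the subspace topology of a product; this splits its neighbourhood
  filter into one factor per curve, so that each parametrization can be applied separately.\<close>

lemma prod_filter_inf_principal:
  "inf (F \<times>\<^sub>F G) (principal (A \<times> B)) = inf F (principal A) \<times>\<^sub>F inf G (principal B)"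
proof (rule filter_eqI)
  fix P :: "'a \<times> 'b \<Rightarrow> bool"
  show "eventually P (inf (F \<times>\<^sub>F G) (principal (A \<times> B))) \<longleftrightarrow>
      eventually P (inf F (principal A) \<times>\<^sub>F inf G (principal B))" (is "?L \<longleftrightarrow> ?R")
  proof
    assume ?L
    then obtain Pf Pg where *: "eventually Pf F" "eventually Pg G"
        "\<And>x y. Pf x \<Longrightarrow> Pg y \<Longrightarrow> x \<in> A \<Longrightarrow> y \<in> B \<Longrightarrow> P (x, y)"
      by (auto simp: eventually_inf_principal eventually_prod_filter)
    then show ?R
      unfolding eventually_inf_principal eventually_prod_filter
      \<comment> \<open>In this direction \<open>P\<close> must follow from the two witnesses alone,
        so membership is built into them.\<close>
      by (intro exI[of _ "\<lambda>x. x \<in> A \<and> Pf x"] exI[of _ "\<lambda>y. y \<in> B \<and> Pg y"])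
        (auto elim: eventually_mono)
  next
    assume ?R
    then obtain Pf Pg where *: "eventually (\<lambda>x. x \<in> A \<longrightarrow> Pf x) F"
        "eventually (\<lambda>y. y \<in> B \<longrightarrow> Pg y) G" "\<And>x y. Pf x \<Longrightarrow> Pg y \<Longrightarrow> P (x, y)"
      by (auto simp: eventually_inf_principal eventually_prod_filter)
    then show ?L
      unfolding eventually_inf_principal eventually_prod_filter
      by (intro exI[of _ "\<lambda>x. x \<in> A \<longrightarrow> Pf x"] exI[of _ "\<lambda>y. y \<in> B \<longrightarrow> Pg y"]) auto
  qed
qed

text \<open>One inequality is continuity of \<open>f\<close>, the other continuity of the inverse
  \<open>g\<close>. Since \<open>U\<close> is open, \<open>X\<close> and \<open>X \<inter> U\<close>
  have the same neighbourhoods of \<open>f u\<close>.\<close>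

lemma homeomorphism_filtermap_nhds:
  fixes f :: "'a::t2_space \<Rightarrow> 'b::topological_space"
  assumes hom: "homeomorphism S (X \<inter> U) f g" and "open S" "open U" "u \<in> S"
  shows "filtermap f (nhds u) = inf (nhds (f u)) (principal X)"
proof (rule antisym)
  have u: "f u \<in> X" "f u \<in> U" "g (f u) = u"
    using hom \<open>u \<in> S\<close> by (auto simp: homeomorphism_def)
  have S: "\<forall>\<^sub>F s in nhds u. s \<in> S"
    using \<open>open S\<close> \<open>u \<in> S\<close> by (rule eventually_nhds_in_open)
  have "isCont f u"
    using hom \<open>open S\<close> \<open>u \<in> S\<close> by (auto simp: homeomorphism_def continuous_on_eq_continuous_at)
  then have "filtermap f (nhds u) \<le> nhds (f u)"
    by (simp only: isCont_def tendsto_at_iff_tendsto_nhds flip: filterlim_def)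
  moreover have "filtermap f (nhds u) \<le> principal X"
    using S hom by (auto simp: le_principal eventually_filtermap homeomorphism_def
        elim!: eventually_mono)
  ultimately show "filtermap f (nhds u) \<le> inf (nhds (f u)) (principal X)"
    by simp
  show "inf (nhds (f u)) (principal X) \<le> filtermap f (nhds u)"
  proof (rule filter_leI)
    fix P assume "eventually P (filtermap f (nhds u))"
    then have P: "\<forall>\<^sub>F s in nhds u. P (f s)"
      by (simp add: eventually_filtermap)
    have "(g \<longlongrightarrow> g (f u)) (at (f u) within X \<inter> U)"
      using homeomorphism_cont2[OF hom] u(1,2) unfolding continuous_on_def by blast
    then have "\<forall>\<^sub>F x in at (f u) within X \<inter> U. P (f (g x))"
      using P unfolding u(3) filterlim_iff by blast
    moreover have "\<forall>\<^sub>F x in nhds (f u). x \<in> U"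
      using \<open>open U\<close> u(2) by (rule eventually_nhds_in_open)
    ultimately have "\<forall>\<^sub>F x in nhds (f u). x \<noteq> f u \<longrightarrow> x \<in> X \<longrightarrow> P x"
      unfolding eventually_at_filter
      by eventually_elim (use hom in \<open>auto simp: homeomorphism_def\<close>)
    \<comment> \<open>The limit of \<open>g\<close> ignores the point \<open>f u\<close> itself, so
      this case is supplied separately.\<close>
    moreover have "P (f u)"
      using P by (rule eventually_nhds_x_imp_x)
    ultimately show "eventually P (inf (nhds (f u)) (principal X))"
      unfolding eventually_inf_principal by (auto elim!: eventually_mono)
  qed
qed

text \<open>Extracts the local facts on which the rest works: the image of the neighbourhood filter,
  first derivatives near 0, and the Frenet form of the second derivative at 0.\<close>

lemma arclength_param_at_props:
  assumes "arclength_param_at X p \<gamma>"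
  shows "\<gamma> 0 = p"
    and "filtermap \<gamma> (nhds 0) = inf (nhds p) (principal X)"
    and "\<forall>\<^sub>F s in nhds 0. (\<gamma> has_vector_derivative tangent \<gamma> s) (at s)"
    and "(tangent \<gamma> has_vector_derivative curvature \<gamma> 0 *\<^sub>R normal \<gamma> 0) (at 0)"
    and "norm (tangent \<gamma> 0) = 1"
proof -
  obtain \<epsilon> U g where *: "\<gamma> 0 = p" "\<epsilon> > 0" "open U" "homeomorphism {-\<epsilon><..<\<epsilon>} (X \<inter> U) \<gamma> g"
      "C2_on \<gamma> {-\<epsilon><..<\<epsilon>}" and unit: "\<And>s. s \<in> {-\<epsilon><..<\<epsilon>} \<Longrightarrow> norm (tangent \<gamma> s) = 1"
    using assms by (auto simp: arclength_param_at_def tangent_def)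
  show "\<gamma> 0 = p"
    by fact
  show "filtermap \<gamma> (nhds 0) = inf (nhds p) (principal X)"
    using homeomorphism_filtermap_nhds[OF *(4), of 0] * by simp
  have "\<forall>\<^sub>F s in nhds 0. s \<in> {-\<epsilon><..<\<epsilon>}"
    using \<open>\<epsilon> > 0\<close> by (intro eventually_nhds_in_open) auto
  then show "\<forall>\<^sub>F s in nhds 0. (\<gamma> has_vector_derivative tangent \<gamma> s) (at s)"
    by eventually_elim
      (use *(5) in \<open>auto simp: C2_on_def C1_differentiable_on_eq vector_derivative_works tangent_def\<close>)
  show "(tangent \<gamma> has_vector_derivative curvature \<gamma> 0 *\<^sub>R normal \<gamma> 0) (at 0)"
    using Frenet_equations(1)[OF *(5) _ _ unit] \<open>\<epsilon> > 0\<close> by simp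
  show "norm (tangent \<gamma> 0) = 1"
    using unit \<open>\<epsilon> > 0\<close> by simp
qed

lemma minimum_type_param:
  assumes "arclength_param_at X a \<alpha>" "arclength_param_at Y b \<beta>"
  shows "minimum_type f (X \<times> Y) (a, b) \<longleftrightarrow>
    (\<forall>\<^sub>F x in nhds 0. f (\<alpha> 0, \<beta> 0) \<le> f (\<alpha> (fst x), \<beta> (snd x)))"
proof -
  note A = arclength_param_at_props[OF assms(1)] and B = arclength_param_at_props[OF assms(2)]
  \<comment> \<open>Punctured neighbourhoods may be replaced by full ones, because the inequality is
    trivial at \<open>(a, b)\<close>.\<close>
  have "minimum_type f (X \<times> Y) (a, b) \<longleftrightarrow>
      (\<forall>\<^sub>F x in inf (nhds (a, b)) (principal (X \<times> Y)). f (a, b) \<le> f x)"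
    unfolding minimum_type_def eventually_at_filter eventually_inf_principal
    by (intro arg_cong[where f = "\<lambda>P. eventually P _"]) auto
  also have "inf (nhds (a, b)) (principal (X \<times> Y)) =
      filtermap (apsnd \<beta>) (filtermap (apfst \<alpha>) (nhds 0))"
    by (simp add: nhds_prod prod_filter_inf_principal prod_filtermap1 prod_filtermap2 zero_prod_def
        flip: A(2) B(2))
  finally show ?thesis
    by (simp add: eventually_filtermap A(1) B(1) apfst_def apsnd_def map_prod_def case_prod_unfold)
qed

lemma maximum_type_iff_minimum_type: "maximum_type f M p \<longleftrightarrow> minimum_type (\<lambda>x. - f x) M p"
  by (simp add: maximum_type_def minimum_type_def)

section \<open>Second order expansions and what they say about local extrema\<close>

text \<open>Subtracting the quadratic term leaves a curve whose derivative differs from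
  \<open>\<gamma>' 0\<close> by at most \<open>e * \<bar>s\<bar>\<close> between 0 and
  \<open>s\<close>; the mean value inequality, which also holds for vector values, then gives the
  bound.\<close>

lemma taylor2_peano:
  fixes \<gamma> :: "real \<Rightarrow> 'a::real_normed_vector"
  assumes D: "\<forall>\<^sub>F s in nhds 0. (\<gamma> has_vector_derivative \<gamma>' s) (at s)"
    and D2: "(\<gamma>' has_vector_derivative A) (at 0)" and "e > 0"
  shows "\<forall>\<^sub>F s in nhds 0. norm (\<gamma> s - \<gamma> 0 - s *\<^sub>R \<gamma>' 0 - (s\<^sup>2 / 2) *\<^sub>R A) \<le> e * s\<^sup>2"
proof -
  obtain d1 where d1: "d1 > 0" "\<And>s. \<bar>s\<bar> < d1 \<Longrightarrow> (\<gamma> has_vector_derivative \<gamma>' s) (at s)"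
    using D by (auto simp: eventually_nhds_metric dist_norm)
  obtain d2 where d2: "d2 > 0" "\<And>s. \<bar>s\<bar> < d2 \<Longrightarrow> norm (\<gamma>' s - \<gamma>' 0 - s *\<^sub>R A) \<le> e * \<bar>s\<bar>"
    using D2 \<open>e > 0\<close> unfolding has_vector_derivative_def has_derivative_at_alt by force
  have "norm (\<gamma> s - \<gamma> 0 - s *\<^sub>R \<gamma>' 0 - (s\<^sup>2 / 2) *\<^sub>R A) \<le> e * s\<^sup>2" if s: "\<bar>s\<bar> < min d1 d2" for s
  proof -
    let ?S = "closed_segment 0 s"
    have S: "\<bar>x\<bar> \<le> \<bar>s\<bar>" if "x \<in> ?S" for x
      using that by (auto simp: closed_segment_eq_real_ivl split: if_splits)
    \<comment> \<open>The vanishing terms are written out so that the goal is an instance of the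
      mean value inequality for \<open>\<gamma> x - (x\<^sup>2 / 2) *\<^sub>R A\<close> with base
      point 0.\<close>
    have "norm ((\<gamma> s - (s\<^sup>2 / 2) *\<^sub>R A) - (\<gamma> 0 - (0\<^sup>2 / 2) *\<^sub>R A) - (s - 0) *\<^sub>R (\<gamma>' 0 - 0 *\<^sub>R A))
        \<le> norm (s - 0) * (e * \<bar>s\<bar>)"
    proof (rule vector_differentiable_bound_linearization[of ?S])
      fix x assume x: "x \<in> ?S"
      have "((\<lambda>x. \<gamma> x - (x\<^sup>2 / 2) *\<^sub>R A) has_vector_derivative \<gamma>' x - x *\<^sub>R A) (at x)"
        using d1(2)[of x] S[OF x] s by (auto intro!: derivative_eq_intros)
      then show "((\<lambda>x. \<gamma> x - (x\<^sup>2 / 2) *\<^sub>R A) has_vector_derivative \<gamma>' x - x *\<^sub>R A) (at x within ?S)"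
        by (rule has_vector_derivative_at_within)
      have "norm (\<gamma>' x - \<gamma>' 0 - x *\<^sub>R A) \<le> e * \<bar>x\<bar>"
        using d2(2)[of x] S[OF x] s by simp
      also have "\<dots> \<le> e * \<bar>s\<bar>"
        using S[OF x] \<open>e > 0\<close> by simp
      finally show "norm (\<gamma>' x - x *\<^sub>R A - (\<gamma>' 0 - 0 *\<^sub>R A)) \<le> e * \<bar>s\<bar>"
        by (simp add: algebra_simps)
    qed auto
    then show ?thesis
      by (simp add: algebra_simps power2_eq_square)
  qed
  then show ?thesis
    using d1(1) d2(1) by (auto simp: eventually_nhds_metric dist_norm intro!: exI[of _ "min d1 d2"])
qed

text \<open>The expansion G(x) = G(0) + Q(x) + o(|x|^2), without a linear term because it is applied
  at a critical point.\<close>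

definition second_order_approx ::
    "('a::real_normed_vector \<Rightarrow> real) \<Rightarrow> ('a \<Rightarrow> real) \<Rightarrow> bool" where
  "second_order_approx G Q \<longleftrightarrow>
    (\<forall>e>0. \<forall>\<^sub>F x in nhds 0. \<bar>G x - G 0 - Q x\<bar> \<le> e * (norm x)\<^sup>2)"

lemma second_order_approx_uminus:
  "second_order_approx G Q \<Longrightarrow> second_order_approx (\<lambda>x. - G x) (\<lambda>x. - Q x)"
  unfolding second_order_approx_def
  by (elim all_forward imp_forward eventually_mono) (auto simp: abs_le_iff algebra_simps)

text \<open>The error bound with \<open>e = m\<close> is absorbed by the coercivity of
  \<open>Q\<close>.\<close>

lemma second_order_approx_minimum:
  assumes "second_order_approx G Q" "m > 0" "\<And>x. m * (norm x)\<^sup>2 \<le> Q x"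
  shows "\<forall>\<^sub>F x in nhds 0. G 0 \<le> G x"
proof -
  have "\<forall>\<^sub>F x in nhds 0. \<bar>G x - G 0 - Q x\<bar> \<le> m * (norm x)\<^sup>2"
    using assms(1,2) by (simp add: second_order_approx_def)
  then show ?thesis
    by eventually_elim (use assms(3) in \<open>smt (verit)\<close>)
qed

text \<open>Along the ray through \<open>v\<close> both \<open>Q\<close> and the error bound scale
  by \<open>r\<^sup>2\<close>, so a negative value of \<open>Q\<close> persists arbitrarily close to
  0.\<close>

lemma second_order_approx_not_minimum:
  assumes "second_order_approx G Q" "\<And>r x. Q (r *\<^sub>R x) = r\<^sup>2 * Q x" "Q v < 0"
  shows "\<not> (\<forall>\<^sub>F x in nhds 0. G 0 \<le> G x)"
proof
  assume min: "\<forall>\<^sub>F x in nhds 0. G 0 \<le> G x"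
  have "v \<noteq> 0"
    using assms(2)[of 0 v] assms(3) by auto
  \<comment> \<open>With this choice the error can cancel at most half of \<open>Q\<close> on the
    ray, leaving \<open>r\<^sup>2 * (Q v / 2)\<close>.\<close>
  define e where "e = - Q v / (2 * (norm v)\<^sup>2)"
  have e: "e > 0" "e * (norm v)\<^sup>2 = - Q v / 2"
    using \<open>v \<noteq> 0\<close> \<open>Q v < 0\<close> by (simp_all add: e_def divide_neg_pos)
  have "\<forall>\<^sub>F x in nhds 0. \<bar>G x - G 0 - Q x\<bar> \<le> e * (norm x)\<^sup>2"
    using assms(1) e(1) by (simp add: second_order_approx_def)
  with min have *: "\<forall>\<^sub>F x in nhds 0. 0 \<le> Q x + e * (norm x)\<^sup>2"
    by eventually_elim auto
  have "((\<lambda>r. r *\<^sub>R v) \<longlongrightarrow> 0) (at_right (0::real))"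
    by (auto intro!: tendsto_eq_intros)
  from filterlim_iff[THEN iffD1, OF this, rule_format, OF *]
  have "\<forall>\<^sub>F r in at_right (0::real). 0 \<le> Q (r *\<^sub>R v) + e * (norm (r *\<^sub>R v))\<^sup>2" .
  moreover have "\<forall>\<^sub>F r in at_right (0::real). r > 0"
    by (simp add: eventually_at_right_less)
  ultimately have "\<forall>\<^sub>F r in at_right (0::real). False"
  proof eventually_elim
    fix r :: real assume r: "0 \<le> Q (r *\<^sub>R v) + e * (norm (r *\<^sub>R v))\<^sup>2" "r > 0"
    have "Q (r *\<^sub>R v) + e * (norm (r *\<^sub>R v))\<^sup>2 = r\<^sup>2 * (Q v + e * (norm v)\<^sup>2)"
      by (simp add: assms(2) power_mult_distrib algebra_simps)
    also have "\<dots> = r\<^sup>2 * (Q v / 2)"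
      unfolding e(2) by simp
    also have "\<dots> < 0"
      using r(2) \<open>Q v < 0\<close> by (simp add: mult_pos_neg)
    finally show False
      using r(1) by simp
  qed
  then show False
    by (simp add: trivial_limit_at_right_real)
qed

text \<open>Write \<open>\<alpha> s - \<beta> t = c + L + w\<close> with \<open>L\<close> linear in \<open>(s, t)\<close> and orthogonal to \<open>c\<close>, and \<open>w\<close>
  of second order; up to second order, the squared norm changes by \<open>L \<bullet> L + 2 * (c \<bullet> w)\<close>.\<close>
lemma sqdist_second_order_approx:
  fixes \<alpha> \<beta> \<alpha>' \<beta>' :: "real \<Rightarrow> real^2" and A B :: "real^2"
  assumes "\<forall>\<^sub>F s in nhds 0. (\<alpha> has_vector_derivative \<alpha>' s) (at s)"
    and "\<forall>\<^sub>F t in nhds 0. (\<beta> has_vector_derivative \<beta>' t) (at t)"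
    and "(\<alpha>' has_vector_derivative A) (at 0)" "(\<beta>' has_vector_derivative B) (at 0)"
    and unit: "norm (\<alpha>' 0) = 1" "norm (\<beta>' 0) = 1"
    and orth: "(\<alpha> 0 - \<beta> 0) \<bullet> \<alpha>' 0 = 0" "(\<alpha> 0 - \<beta> 0) \<bullet> \<beta>' 0 = 0"
  shows "second_order_approx (\<lambda>x. sqdist (\<alpha> (fst x), \<beta> (snd x)))
    (\<lambda>x. ((\<alpha> 0 - \<beta> 0) \<bullet> A + 1) * (fst x)\<^sup>2 - 2 * (\<alpha>' 0 \<bullet> \<beta>' 0) * fst x * snd x
       + ((\<beta> 0 - \<alpha> 0) \<bullet> B + 1) * (snd x)\<^sup>2)"
  unfolding second_order_approx_def
proof (intro allI impI)
  fix e :: real assume "e > 0"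
  define c where "c = \<alpha> 0 - \<beta> 0"
  \<comment> \<open>\<open>d\<close> is the relative size of the Taylor remainders. The bound 1
    keeps the estimate of \<open>w\<close> independent of \<open>e\<close>; the added 1 in the
    denominator covers \<open>c = 0\<close> and makes \<open>2 * norm c * d < e\<close>
    strict.\<close>
  define d where "d = min 1 (e / (2 * norm c + 1))"
  have "e / (2 * norm c + 1) > 0"
    using \<open>e > 0\<close> by (intro divide_pos_pos) (auto intro: add_nonneg_pos)
  then have d: "d > 0" "d \<le> 1" "d \<le> e / (2 * norm c + 1)"
    unfolding d_def by simp_all
  have "d * (2 * norm c + 1) \<le> e"
    using d(3) by (subst (asm) pos_le_divide_eq) (auto intro: add_nonneg_pos)
  then have d': "2 * norm c * d < e"
    using d(1) by (simp add: algebra_simps)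
  \<comment> \<open>\<open>K\<close> will bound \<open>w\<close> relative to s^2 + t^2; the summand
    1 accounts for the remainders, since \<open>d \<le> 1\<close>.\<close>
  define K where "K = norm A + norm B + 1"
  have K: "K > 0"
    by (auto simp: K_def intro: add_nonneg_pos)
  define \<rho> where "\<rho> s = \<alpha> s - \<alpha> 0 - s *\<^sub>R \<alpha>' 0 - (s\<^sup>2 / 2) *\<^sub>R A" for s
  define \<theta> where "\<theta> t = \<beta> t - \<beta> 0 - t *\<^sub>R \<beta>' 0 - (t\<^sup>2 / 2) *\<^sub>R B" for t
  have "\<forall>\<^sub>F s in nhds 0. norm (\<rho> s) \<le> d * s\<^sup>2" "\<forall>\<^sub>F t in nhds 0. norm (\<theta> t) \<le> d * t\<^sup>2"
    unfolding \<rho>_def \<theta>_def using assms(1-4) d(1) by (auto intro: taylor2_peano)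
  then have "\<forall>\<^sub>F x in nhds 0. norm (\<rho> (fst x)) \<le> d * (fst x)\<^sup>2 \<and> norm (\<theta> (snd x)) \<le> d * (snd x)\<^sup>2"
    unfolding zero_prod_def nhds_prod by (rule eventually_prodI)
  moreover
  \<comment> \<open>This is the factor in front of s^2 + t^2 in the final error estimate. Only its
    first summand survives at the origin, and that is below \<open>e\<close>.\<close>
  have "((\<lambda>x::real\<times>real. 2 * norm c * d + 2 * (\<bar>fst x\<bar> + \<bar>snd x\<bar>) * K + K\<^sup>2 * ((fst x)\<^sup>2 + (snd x)\<^sup>2))
      \<longlongrightarrow> 2 * norm c * d) (nhds 0)"
    by (auto intro!: tendsto_eq_intros filterlim_ident)
  then have "\<forall>\<^sub>F x::real\<times>real in nhds 0.
      2 * norm c * d + 2 * (\<bar>fst x\<bar> + \<bar>snd x\<bar>) * K + K\<^sup>2 * ((fst x)\<^sup>2 + (snd x)\<^sup>2) < e"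
    using d' by (rule order_tendstoD)
  ultimately show "\<forall>\<^sub>F x in nhds 0. \<bar>sqdist (\<alpha> (fst x), \<beta> (snd x)) - sqdist (\<alpha> (fst 0), \<beta> (snd 0))
      - (((\<alpha> 0 - \<beta> 0) \<bullet> A + 1) * (fst x)\<^sup>2 - 2 * (\<alpha>' 0 \<bullet> \<beta>' 0) * fst x * snd x
       + ((\<beta> 0 - \<alpha> 0) \<bullet> B + 1) * (snd x)\<^sup>2)\<bar> \<le> e * (norm x)\<^sup>2"
  proof eventually_elim
    case (elim x)
    obtain s t where x: "x = (s, t)"
      by (cases x)
    define N where "N = s\<^sup>2 + t\<^sup>2"
    have N: "N \<ge> 0" "(norm x)\<^sup>2 = N"
      by (auto simp: N_def x norm_Pair)
    define r where "r = \<rho> s - \<theta> t"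
    define L where "L = s *\<^sub>R \<alpha>' 0 - t *\<^sub>R \<beta>' 0"
    define w where "w = (s\<^sup>2 / 2) *\<^sub>R A - (t\<^sup>2 / 2) *\<^sub>R B + r"
    have r: "norm r \<le> d * N"
      using elim norm_triangle_ineq4[of "\<rho> s" "\<theta> t"] by (simp add: r_def N_def x algebra_simps)
    have L: "norm L \<le> \<bar>s\<bar> + \<bar>t\<bar>"
      using norm_triangle_ineq4[of "s *\<^sub>R \<alpha>' 0" "t *\<^sub>R \<beta>' 0"] unit by (simp add: L_def)
    have "norm w \<le> norm ((s\<^sup>2 / 2) *\<^sub>R A) + norm ((t\<^sup>2 / 2) *\<^sub>R B) + norm r"
      unfolding w_def by (meson norm_triangle_ineq norm_triangle_ineq4 add_mono order.trans order_refl)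
    also have "\<dots> \<le> N * norm A + N * norm B + 1 * N"
    proof (intro add_mono)
      have "s\<^sup>2 / 2 \<le> N" "t\<^sup>2 / 2 \<le> N"
        by (simp_all add: N_def add_nonneg_nonneg)
      then have "s\<^sup>2 / 2 * norm A \<le> N * norm A" "t\<^sup>2 / 2 * norm B \<le> N * norm B"
        by (simp_all only: mult_right_mono norm_ge_zero)
      then show "norm ((s\<^sup>2 / 2) *\<^sub>R A) \<le> N * norm A" "norm ((t\<^sup>2 / 2) *\<^sub>R B) \<le> N * norm B"
        by simp_all
      show "norm r \<le> 1 * N"
        using r d(2) N(1) by (meson mult_right_mono order.trans)
    qed
    finally have w: "norm w \<le> K * N"
      by (simp add: K_def algebra_simps)
    have eq: "\<alpha> s - \<beta> t = c + L + w"
      by (simp add: c_def L_def w_def r_def \<rho>_def \<theta>_def algebra_simps)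
    have cL: "c \<bullet> L = 0"
      using orth by (simp add: c_def L_def inner_diff_right)
    have LL: "L \<bullet> L = s\<^sup>2 - 2 * (\<alpha>' 0 \<bullet> \<beta>' 0) * s * t + t\<^sup>2"
      using unit by (simp add: L_def norm_eq_1 inner_diff_left inner_diff_right
          inner_commute power2_eq_square algebra_simps)
    have cw: "c \<bullet> w = s\<^sup>2 / 2 * (c \<bullet> A) - t\<^sup>2 / 2 * (c \<bullet> B) + c \<bullet> r"
      by (simp add: w_def inner_add_right inner_diff_right)
    have sq: "sqdist (\<alpha> s, \<beta> t) = c \<bullet> c + L \<bullet> L + 2 * (c \<bullet> w) + 2 * (L \<bullet> w) + w \<bullet> w"
      unfolding sqdist_def prod.case eq using cL
      by (simp add: power2_norm_eq_inner inner_add_left inner_add_right inner_commute)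
    have sq0: "sqdist (\<alpha> 0, \<beta> 0) = c \<bullet> c"
      by (simp add: sqdist_def c_def power2_norm_eq_inner)
    have cB: "(\<beta> 0 - \<alpha> 0) \<bullet> B = - (c \<bullet> B)"
      by (simp add: c_def inner_diff_left)
    \<comment> \<open>Once the quadratic form is removed, \<open>c \<bullet> r\<close> is small
      through \<open>d\<close>, while \<open>L \<bullet> w\<close> and \<open>w \<bullet> w\<close>
      are of third and fourth order.\<close>
    have "sqdist (\<alpha> s, \<beta> t) - sqdist (\<alpha> 0, \<beta> 0)
      - (((\<alpha> 0 - \<beta> 0) \<bullet> A + 1) * s\<^sup>2 - 2 * (\<alpha>' 0 \<bullet> \<beta>' 0) * s * t + ((\<beta> 0 - \<alpha> 0) \<bullet> B + 1) * t\<^sup>2)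
      = 2 * (c \<bullet> r) + 2 * (L \<bullet> w) + w \<bullet> w"
      unfolding sq sq0 cB LL cw c_def[symmetric] by (simp add: field_simps)
    also have "\<bar>\<dots>\<bar> \<le> 2 * (norm c * norm r) + 2 * (norm L * norm w) + norm w * norm w"
      using Cauchy_Schwarz_ineq2[of c r] Cauchy_Schwarz_ineq2[of L w] Cauchy_Schwarz_ineq2[of w w]
      by linarith
    also have "\<dots> \<le> 2 * (norm c * (d * N)) + 2 * ((\<bar>s\<bar> + \<bar>t\<bar>) * (K * N)) + (K * N) * (K * N)"
      using r L w K N by (intro add_mono mult_mono mult_left_mono) auto
    also have "\<dots> = (2 * norm c * d + 2 * (\<bar>s\<bar> + \<bar>t\<bar>) * K + K\<^sup>2 * N) * N"
      by (simp add: algebra_simps power2_eq_square)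
    also have "\<dots> \<le> e * N"
      using elim N(1) by (intro mult_right_mono) (auto simp: x N_def)
    finally show ?case
      by (simp add: x N(2)[unfolded x])
  qed
qed

section \<open>Binary quadratic forms, and unit vectors with a common normal\<close>

lemma quadratic_form_pos_def:
  fixes p q \<sigma> :: real
  assumes "p > 0" "q > 0" "p * q > \<sigma>\<^sup>2"
  obtains m where "m > 0" "\<And>s t. m * (s\<^sup>2 + t\<^sup>2) \<le> p * s\<^sup>2 - 2 * \<sigma> * s * t + q * t\<^sup>2"
proof
  \<comment> \<open>Determinant over trace: for two positive eigenvalues this lies below the smaller
    one.\<close>
  define m where "m = (p * q - \<sigma>\<^sup>2) / (p + q)"
  show "m > 0"
    using assms by (simp add: m_def)
  have m: "m * (p + q) = p * q - \<sigma>\<^sup>2"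
    using assms by (simp add: m_def)
  have "m * (p + q) < p * (p + q)"
    unfolding m using assms by (simp add: algebra_simps add_pos_nonneg)
  then have "m < p"
    using assms by simp
  fix s t :: real
  \<comment> \<open>Completing the square; the coefficient of t^2 is (p - m)(q - m) - \<sigma>^2,
    which equals m^2 by the choice of \<open>m\<close>.\<close>
  have "(p - m) * (p * s\<^sup>2 - 2 * \<sigma> * s * t + q * t\<^sup>2 - m * (s\<^sup>2 + t\<^sup>2)) =
      ((p - m) * s - \<sigma> * t)\<^sup>2 + m\<^sup>2 * t\<^sup>2"
    using m by algebra
  also have "\<dots> \<ge> 0"
    by simp
  finally show "m * (s\<^sup>2 + t\<^sup>2) \<le> p * s\<^sup>2 - 2 * \<sigma> * s * t + q * t\<^sup>2"
    using \<open>m < p\<close> by (simp add: zero_le_mult_iff)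
qed

lemma quadratic_form_indefinite:
  fixes p q \<sigma> :: real
  assumes "p * q < \<sigma>\<^sup>2"
  obtains s t where "p * s\<^sup>2 - 2 * \<sigma> * s * t + q * t\<^sup>2 < 0"
proof (cases "p > 0")
  case True
  \<comment> \<open>The witness is s = \<sigma>, t = p: for fixed t the form is least at s =
    \<sigma> t / p, and scaling by \<open>p\<close> clears the denominator.\<close>
  have "p * \<sigma>\<^sup>2 - 2 * \<sigma> * \<sigma> * p + q * p\<^sup>2 = p * (p * q - \<sigma>\<^sup>2)"
    by (simp add: algebra_simps power2_eq_square)
  also have "\<dots> < 0"
    using True assms by (simp add: mult_pos_neg)
  finally show ?thesis
    by (rule that)
next
  case False
  show ?thesis
  proof (cases "p = 0")
    case True
    then have "\<sigma> \<noteq> 0"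
      using assms by auto
    \<comment> \<open>With \<open>p = 0\<close> and t = 1 the form is affine in s; this s gives the
      value -1.\<close>
    then have "p * ((q + 1) / (2 * \<sigma>))\<^sup>2 - 2 * \<sigma> * ((q + 1) / (2 * \<sigma>)) * 1 + q * 1\<^sup>2 < 0"
      using True by simp
    then show ?thesis
      by (rule that)
  next
    case False
    then show ?thesis
      using \<open>\<not> p > 0\<close> that[of 1 0] by simp
  qed
qed

text \<open>In the plane the vectors orthogonal to \<open>c\<close> form a line, so \<open>u\<close>
  and \<open>v\<close> are equal or opposite. This turns the determinant p q - \<sigma>^2 into p q -
  1.\<close>

lemma orthogonal_unit_vectors_plane:
  fixes c u v :: "real^2"
  assumes "c \<noteq> 0" "c \<bullet> u = 0" "c \<bullet> v = 0" "norm u = 1" "norm v = 1"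
  shows "(u \<bullet> v)\<^sup>2 = 1"
proof -
  have c: "c $ 1 \<noteq> 0 \<or> c $ 2 \<noteq> 0"
    using assms(1) by (auto simp: vec_eq_iff forall_2)
  have *: "c $ 1 * u $ 1 + c $ 2 * u $ 2 = 0" "c $ 1 * v $ 1 + c $ 2 * v $ 2 = 0"
      "u $ 1 * u $ 1 + u $ 2 * u $ 2 = 1" "v $ 1 * v $ 1 + v $ 2 * v $ 2 = 1"
    using assms by (simp_all add: inner_vec_def sum_2 norm_eq_1)
  have "c $ 1 * (u $ 1 * v $ 2 - u $ 2 * v $ 1) = 0" "c $ 2 * (u $ 1 * v $ 2 - u $ 2 * v $ 1) = 0"
    using * by algebra+
  with c have "u $ 1 * v $ 2 - u $ 2 * v $ 1 = 0"
    by auto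
  \<comment> \<open>Lagrange's identity: the squares of the inner product and of the determinant of
    \<open>u\<close>, \<open>v\<close> add up to |u|^2 |v|^2.\<close>
  with *(3,4) have "(u $ 1 * v $ 1 + u $ 2 * v $ 2)\<^sup>2 = 1"
    by algebra
  then show ?thesis
    by (simp add: inner_vec_def sum_2)
qed

section \<open>Entries of the Hessian matrix\<close>

lemma DERIV_half_sqdist:
  assumes "(\<gamma> has_vector_derivative v) (at s)"
  shows "((\<lambda>s. 1/2 * sqdist (\<gamma> s, y)) has_field_derivative (\<gamma> s - y) \<bullet> v) (at s)"
proof -
  have "((\<lambda>s. \<gamma> s - y) has_vector_derivative v) (at s)"
    using assms by (auto intro!: derivative_eq_intros)
  from bounded_bilinear.has_vector_derivative[OF bounded_bilinear_inner this this]
  have "((\<lambda>s. (\<gamma> s - y) \<bullet> (\<gamma> s - y)) has_field_derivative 2 * ((\<gamma> s - y) \<bullet> v)) (at s)"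
    by (simp add: has_real_derivative_iff_has_vector_derivative inner_commute)
  from DERIV_cmult[OF this, of "1/2"] show ?thesis
    by (simp add: sqdist_def power2_norm_eq_inner)
qed

lemma sqdist_commute: "sqdist (x, y) = sqdist (y, x)"
  by (simp add: sqdist_def norm_minus_commute)

text \<open>Product rule for (\<gamma> - y) \<bullet> \<gamma>': the summand 1 is the squared speed,
  and for \<open>A\<close> equal to curvature times normal the result is the index
  indicator.\<close>

lemma deriv_deriv_half_sqdist:
  assumes D: "\<forall>\<^sub>F s in nhds 0. (\<gamma> has_vector_derivative \<gamma>' s) (at s)"
    and D2: "(\<gamma>' has_vector_derivative A) (at 0)" and "norm (\<gamma>' 0) = 1"
  shows "deriv (\<lambda>s. deriv (\<lambda>s'. 1/2 * sqdist (\<gamma> s', y)) s) 0 = (\<gamma> 0 - y) \<bullet> A + 1"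
proof -
  have "\<forall>\<^sub>F s in nhds 0. deriv (\<lambda>s'. 1/2 * sqdist (\<gamma> s', y)) s = (\<gamma> s - y) \<bullet> \<gamma>' s"
    using D by eventually_elim (rule DERIV_imp_deriv[OF DERIV_half_sqdist])
  then have "deriv (\<lambda>s. deriv (\<lambda>s'. 1/2 * sqdist (\<gamma> s', y)) s) 0 = deriv (\<lambda>s. (\<gamma> s - y) \<bullet> \<gamma>' s) 0"
    by (rule deriv_cong_ev) simp
  also have "\<dots> = (\<gamma> 0 - y) \<bullet> A + 1"
  proof (rule DERIV_imp_deriv)
    have "(\<gamma> has_vector_derivative \<gamma>' 0) (at 0)"
      using D by (rule eventually_nhds_x_imp_x)
    then have "((\<lambda>s. \<gamma> s - y) has_vector_derivative \<gamma>' 0) (at 0)"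
      by (auto intro!: derivative_eq_intros)
    from bounded_bilinear.has_vector_derivative[OF bounded_bilinear_inner this D2] assms(3)
    show "((\<lambda>s. (\<gamma> s - y) \<bullet> \<gamma>' s) has_field_derivative (\<gamma> 0 - y) \<bullet> A + 1) (at 0)"
      by (simp add: has_real_derivative_iff_has_vector_derivative norm_eq_1)
  qed
  finally show ?thesis .
qed

text \<open>The inner derivative at 0 is an affine function of \<open>\<alpha> s\<close>, so first
  derivatives at 0 determine the mixed entry.\<close>

lemma deriv_deriv_half_sqdist_mixed:
  assumes "(\<alpha> has_vector_derivative u) (at 0)" "(\<beta> has_vector_derivative v) (at 0)"
  shows "deriv (\<lambda>s. deriv (\<lambda>t. 1/2 * sqdist (\<alpha> s, \<beta> t)) 0) 0 = - (u \<bullet> v)"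
proof -
  have "deriv (\<lambda>t. 1/2 * sqdist (\<alpha> s, \<beta> t)) 0 = (\<beta> 0 - \<alpha> s) \<bullet> v" for s
    using DERIV_imp_deriv[OF DERIV_half_sqdist[OF assms(2), of "\<alpha> s"]]
    by (simp add: sqdist_commute)
  moreover have "((\<lambda>s. (\<beta> 0 - \<alpha> s) \<bullet> v) has_vector_derivative - (u \<bullet> v)) (at 0)"
  proof -
    have "((\<lambda>s. \<beta> 0 - \<alpha> s) has_vector_derivative - u) (at 0)"
      using assms(1) by (auto intro!: derivative_eq_intros)
    from bounded_linear.has_vector_derivative[OF bounded_linear_inner_left this]
    show ?thesis
      by simp
  qed
  ultimately show ?thesis
    by (simp add: DERIV_imp_deriv has_real_derivative_iff_has_vector_derivative)
qed

section \<open>The type of the double normal, read off from the quadratic form\<close>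

theorem proposition8:
  fixes Xa Xb :: "(real^2) set" and a b :: "real^2" and \<alpha> \<beta> :: "real \<Rightarrow> real^2"
  assumes "arclength_param_at Xa a \<alpha>"
    and "arclength_param_at Xb b \<beta>"
    and "a \<noteq> b"
    and "double_normal \<alpha> \<beta>"
    and "Morse_critical_point (\<lambda>s t. sqdist (\<alpha> s, \<beta> t)) 0 0"
  shows "H_det \<alpha> \<beta> = index_indicator \<alpha> 0 b * index_indicator \<beta> 0 a - 1
    \<and> (H_det \<alpha> \<beta> < 0 \<longrightarrow> saddle_type sqdist (Xa \<times> Xb) (a, b))
    \<and> (H_det \<alpha> \<beta> > 0 \<and> index_indicator \<alpha> 0 b < 0 \<and> index_indicator \<beta> 0 a < 0
        \<longrightarrow> maximum_type sqdist (Xa \<times> Xb) (a, b))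
    \<and> (H_det \<alpha> \<beta> > 0 \<and> index_indicator \<alpha> 0 b > 0 \<and> index_indicator \<beta> 0 a > 0
        \<longrightarrow> minimum_type sqdist (Xa \<times> Xb) (a, b))"
proof -
  note A = arclength_param_at_props[OF assms(1)] and B = arclength_param_at_props[OF assms(2)]
  have orth: "(\<alpha> 0 - \<beta> 0) \<bullet> tangent \<alpha> 0 = 0" "(\<alpha> 0 - \<beta> 0) \<bullet> tangent \<beta> 0 = 0"
    using assms(4) by (auto simp: double_normal_def orthogonal_def)
  define p where "p = index_indicator \<alpha> 0 b"
  define q where "q = index_indicator \<beta> 0 a"
  define \<sigma> where "\<sigma> = tangent \<alpha> 0 \<bullet> tangent \<beta> 0"
  have p: "(\<alpha> 0 - \<beta> 0) \<bullet> (curvature \<alpha> 0 *\<^sub>R normal \<alpha> 0) + 1 = p"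
    and q: "(\<beta> 0 - \<alpha> 0) \<bullet> (curvature \<beta> 0 *\<^sub>R normal \<beta> 0) + 1 = q"
    by (simp_all add: p_def q_def index_indicator_def A(1) B(1))
  have \<sigma>: "\<sigma>\<^sup>2 = 1"
    unfolding \<sigma>_def using orth A(1,5) B(1,5) \<open>a \<noteq> b\<close>
    by (intro orthogonal_unit_vectors_plane[of "\<alpha> 0 - \<beta> 0"]) auto
  have D: "(\<alpha> has_vector_derivative tangent \<alpha> 0) (at 0)"
      "(\<beta> has_vector_derivative tangent \<beta> 0) (at 0)"
    using A(3) B(3) by (auto intro: eventually_nhds_x_imp_x)
  have H: "H_det \<alpha> \<beta> = p * q - 1"
  proof -
    have "deriv (\<lambda>s. deriv (\<lambda>s'. 1/2 * sqdist (\<alpha> s', \<beta> 0)) s) 0 = p"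
      using deriv_deriv_half_sqdist[OF A(3-5), of "\<beta> 0"] p by simp
    moreover have "deriv (\<lambda>t. deriv (\<lambda>t'. 1/2 * sqdist (\<alpha> 0, \<beta> t')) t) 0 = q"
      using deriv_deriv_half_sqdist[OF B(3-5), of "\<alpha> 0"] q by (simp add: sqdist_commute)
    moreover have "deriv (\<lambda>s. deriv (\<lambda>t. 1/2 * sqdist (\<alpha> s, \<beta> t)) 0) 0 = - \<sigma>"
      using deriv_deriv_half_sqdist_mixed[OF D] by (simp add: \<sigma>_def)
    \<comment> \<open>The other mixed entry comes from the same computation with the two curves
      exchanged.\<close>
    moreover have "deriv (\<lambda>t. deriv (\<lambda>s. 1/2 * sqdist (\<alpha> s, \<beta> t)) 0) 0 = - \<sigma>"
      using deriv_deriv_half_sqdist_mixed[OF D(2,1)]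
      by (simp add: \<sigma>_def sqdist_commute inner_commute)
    ultimately show ?thesis
      using \<sigma> unfolding H_det_def hessian_matrix_def by (simp add: det_2 power2_eq_square)
  qed
  define G where "G x = sqdist (\<alpha> (fst x), \<beta> (snd x))" for x
  define Q where "Q x = p * (fst x)\<^sup>2 - 2 * \<sigma> * fst x * snd x + q * (snd x)\<^sup>2" for x
  have G: "second_order_approx G Q"
    using sqdist_second_order_approx[OF A(3) B(3) A(4) B(4) A(5) B(5) orth]
    unfolding p q G_def[abs_def] Q_def[abs_def] \<sigma>_def .
  have Q: "Q (r *\<^sub>R x) = r\<^sup>2 * Q x" for r x
    by (simp add: Q_def algebra_simps power2_eq_square)
  have min: "minimum_type sqdist (Xa \<times> Xb) (a, b) \<longleftrightarrow> (\<forall>\<^sub>F x in nhds 0. G 0 \<le> G x)"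
    by (simp add: minimum_type_param[OF assms(1,2)] G_def)
  \<comment> \<open>Maxima are minima of \<open>- G\<close>, whose quadratic form has coefficients
    \<open>- p\<close>, \<open>- \<sigma>\<close>, \<open>- q\<close>.\<close>
  have max: "maximum_type sqdist (Xa \<times> Xb) (a, b) \<longleftrightarrow> (\<forall>\<^sub>F x in nhds 0. - G 0 \<le> - G x)"
    by (simp add: maximum_type_iff_minimum_type minimum_type_param[OF assms(1,2)] G_def)
  have norm: "(norm x)\<^sup>2 = (fst x)\<^sup>2 + (snd x)\<^sup>2" for x :: "real \<times> real"
    by (simp add: norm_prod_def)
  note G' = second_order_approx_uminus[OF G]
  have "saddle_type sqdist (Xa \<times> Xb) (a, b)" if "p * q < 1"
  proof -
    \<comment> \<open>Negation preserves the determinant, so one inequality yields a direction of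
      descent and also one of ascent.\<close>
    have "p * q < \<sigma>\<^sup>2" "- p * - q < (- \<sigma>)\<^sup>2"
      using that \<sigma> by simp_all
    note indefinite = this[THEN quadratic_form_indefinite]
    obtain s t where "p * s\<^sup>2 - 2 * \<sigma> * s * t + q * t\<^sup>2 < 0"
      by (rule indefinite(1))
    then have "Q (s, t) < 0"
      by (simp add: Q_def)
    then have "\<not> minimum_type sqdist (Xa \<times> Xb) (a, b)"
      unfolding min using second_order_approx_not_minimum[OF G Q] by blast
    moreover obtain s t where "- p * s\<^sup>2 - 2 * - \<sigma> * s * t + - q * t\<^sup>2 < 0"
      by (rule indefinite(2))
    then have "- Q (s, t) < 0"
      by (simp add: Q_def)
    then have "\<not> maximum_type sqdist (Xa \<times> Xb) (a, b)"
      unfolding max using second_order_approx_not_minimum[OF G'] Q by simp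
    ultimately show ?thesis
      by (simp add: saddle_type_def)
  qed
  moreover have "minimum_type sqdist (Xa \<times> Xb) (a, b)" if pq: "p * q > 1" "p > 0" "q > 0"
  proof -
    obtain m where "m > 0" "\<And>s t. m * (s\<^sup>2 + t\<^sup>2) \<le> p * s\<^sup>2 - 2 * \<sigma> * s * t + q * t\<^sup>2"
      using quadratic_form_pos_def[of p q \<sigma>] pq \<sigma> by auto
    then show ?thesis
      unfolding min by (intro second_order_approx_minimum[OF G]) (auto simp: norm Q_def)
  qed
  moreover have "maximum_type sqdist (Xa \<times> Xb) (a, b)" if pq: "p * q > 1" "p < 0" "q < 0"
  proof -
    obtain m where "m > 0" "\<And>s t. m * (s\<^sup>2 + t\<^sup>2) \<le> - p * s\<^sup>2 - 2 * - \<sigma> * s * t + - q * t\<^sup>2"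
      using quadratic_form_pos_def[of "- p" "- q" "- \<sigma>"] pq \<sigma> by auto
    then show ?thesis
      unfolding max
      by (intro second_order_approx_minimum[OF G']) (auto simp: norm Q_def algebra_simps)
  qed
  ultimately show ?thesis
    using H unfolding p_def q_def by auto
qed

end
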